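(* Let $\tau>0$, let $S\in W_2^{n\times n}[-\tau,0]$ and $R\in W_2^{n\times n}[[-\tau,0]\times[-\tau,0]]$, and define, for $\begin{bmatrix} x\\ \phi\end{bmatrix}\in X$, $$\left(\mathcal{P}\begin{bmatrix} x \\ \phi\end{bmatrix}\right)(s):= \begin{bmatrix} \tau( R(0,0)+S(0))x + \int_{-\tau}^0 R(0,\theta)\phi(\theta)\,d \theta \\ \tau R(s,0)\phi(0) + \tau S(s)\phi(s) + \int_{-\tau}^0 R(s,\theta)\phi(\theta)\,d \theta \end{bmatrix}.$$ Suppose $R(s,\theta) = R(\theta,s)^T$ and $S(s)$ is symmetric for all $s,\theta\in[-\tau,0]$. Then $\mathcal{P}$ is self-adjoint with respect to the $L_2^{2n}$ inner product, i.e. $\langle z,\mathcal{P}w\rangle_{L_2^{2n}}=\langle \mathcal{P}z,w\rangle_{L_2^{2n}}$ for all $z,w\in X$.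
   Context: $L_2^m[D]$ denotes the square-integrable functions $D\to\mathbb{R}^m$ and $W_2^m[D]=\{x: x,\dot x\in L_2^m[D]\}$; $W_2^{n\times m}$ is the matrix-valued analogue (for functions of two variables, first-order partial derivatives in $L_2$). Functions in $W_2$ are regarded as continuous, and kernels are assumed sufficiently smooth that the one-variable sections that occur are well defined and lie in $W_2$. The state space is $X:=\{\begin{bmatrix} x\\ \phi\end{bmatrix} : x\in\mathbb{R}^n,\ \phi\in W_2^n[-\tau,0],\ \phi(0)=x\}$. Elements of $\mathbb{R}^n\times L_2^n[-\tau,0]$ are viewed in $L_2^{2n}[-\tau,0]$ by regarding the first component as a constant function, so that $$\left\langle \begin{bmatrix} y\\ \psi\end{bmatrix},\begin{bmatrix} x\\ \phi\end{bmatrix}\right\rangle_{L_2^{2n}}=\int_{-\tau}^0 \big(y^Tx+\psi(s)^T\phi(s)\big)\,ds .$$ *)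

theory Defs
  imports "HOL-Analysis.Analysis"
begin

definition L2 :: "'a::euclidean_space set \<Rightarrow> ('a \<Rightarrow> 'b::euclidean_space) set" where
  "L2 D = {f. f \<in> borel_measurable (lebesgue_on D) \<and>
              integrable (lebesgue_on D) (\<lambda>x. (norm (f x))\<^sup>2)}"

text \<open>
  Weak derivative of \<open>f\<close> in direction \<open>i\<close> on \<open>D\<close>, tested against compactly supported
  \<open>C\<^sup>1\<close> functions on the interior of \<open>D\<close>; by mollification, testing against smooth functions
  only gives the same notion for square-integrable \<open>f\<close> and \<open>g\<close>.
\<close>

definition weak_partial ::
  "'a::euclidean_space set \<Rightarrow> 'a \<Rightarrow> ('a \<Rightarrow> 'b::euclidean_space) \<Rightarrow> ('a \<Rightarrow> 'b) \<Rightarrow> bool" where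
  "weak_partial D i f g \<longleftrightarrow>
     (\<forall>(\<eta> :: 'a \<Rightarrow> real) (\<eta>' :: 'a \<Rightarrow> 'a \<Rightarrow>\<^sub>L real).
        (\<forall>x. (\<eta> has_derivative blinfun_apply (\<eta>' x)) (at x)) \<and> continuous_on UNIV \<eta>' \<and>
        compact (closure {x. \<eta> x \<noteq> 0}) \<and> closure {x. \<eta> x \<noteq> 0} \<subseteq> interior D \<longrightarrow>
        (LINT x|lebesgue_on D. blinfun_apply (\<eta>' x) i *\<^sub>R f x)
          = - (LINT x|lebesgue_on D. \<eta> x *\<^sub>R g x))"

text \<open>
  For \<open>D\<close> an interval, \<open>Basis = {1}\<close> and \<open>g\<close> below is the derivative of \<open>f\<close>; for \<open>D\<close> a square,
  \<open>g\<close> runs through the two first-order partial derivatives. Members are by convention the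
  continuous representatives, so that point values are meaningful. Only the values on \<open>D\<close> matter.
\<close>

definition W2 :: "'a::euclidean_space set \<Rightarrow> ('a \<Rightarrow> 'b::euclidean_space) set" where
  "W2 D = {f. continuous_on D f \<and> f \<in> L2 D \<and> (\<forall>i\<in>Basis. \<exists>g\<in>L2 D. weak_partial D i f g)}"

definition state_space :: "real \<Rightarrow> ((real^'n) \<times> (real \<Rightarrow> real^'n)) set" where
  "state_space \<tau> = {(x, \<phi>). \<phi> \<in> W2 {-\<tau>..0} \<and> \<phi> 0 = x}"

text \<open>The finite-dimensional component is regarded as a constant function on \<open>{-\<tau>..0}\<close>.\<close>

definition inner_L2 ::
  "real \<Rightarrow> (real^'n) \<times> (real \<Rightarrow> real^'n) \<Rightarrow> (real^'n) \<times> (real \<Rightarrow> real^'n) \<Rightarrow> real" where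
  "inner_L2 \<tau> z w = (LINT s|lebesgue_on {-\<tau>..0}. fst z \<bullet> fst w + snd z s \<bullet> snd w s)"

definition P_op ::
  "real \<Rightarrow> (real \<times> real \<Rightarrow> real^'n^'n) \<Rightarrow> (real \<Rightarrow> real^'n^'n) \<Rightarrow>
   (real^'n) \<times> (real \<Rightarrow> real^'n) \<Rightarrow> (real^'n) \<times> (real \<Rightarrow> real^'n)" where
  "P_op \<tau> R S = (\<lambda>(x, \<phi>).
     (\<tau> *\<^sub>R ((R (0, 0) + S 0) *v x)
        + (LINT \<theta>|lebesgue_on {-\<tau>..0}. R (0, \<theta>) *v \<phi> \<theta>),
      \<lambda>s. \<tau> *\<^sub>R (R (s, 0) *v \<phi> 0) + \<tau> *\<^sub>R (S s *v \<phi> s)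
        + (LINT \<theta>|lebesgue_on {-\<tau>..0}. R (s, \<theta>) *v \<phi> \<theta>)))"

end

theory Submission
  imports Defs
begin

text \<open>
  The form \<open>\<langle>z, \<P> w\<rangle>\<close> expands into a sum of five integrals. By the symmetry of \<open>R\<close> and \<open>S\<close>,
  exchanging \<open>z\<close> and \<open>w\<close> fixes the terms with \<open>R (0, 0) + S 0\<close> and \<open>S s\<close>, interchanges the two
  terms with \<open>R (0, s)\<close> and \<open>R (s, 0)\<close> (this uses \<open>\<phi> 0 = x\<close>), and reverses the order of integration
  in the double integral with \<open>R (s, \<theta>)\<close>, which Fubini's theorem undoes.
\<close>

lemma continuous_on_matrix_vector_mult:
  fixes A :: "'a::topological_space \<Rightarrow> real^'n^'m"
  assumes "continuous_on D A" "continuous_on D v"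
  shows "continuous_on D (\<lambda>s. A s *v v s)"
  unfolding matrix_vector_mult_def
  using assms by (intro continuous_intros)

lemma inner_transpose_mult:
  fixes A :: "real^'n^'m"
  shows "x \<bullet> (transpose A *v y) = y \<bullet> (A *v x)"
  by (metis dot_lmul_matrix inner_commute transpose_matrix_vector)

text \<open>The definitions use Lebesgue integrals, while continuity in a parameter and the exchange
  of iterated integrals are taken from results on the Henstock-Kurzweil \<open>integral\<close>. On
  a compact interval a continuous integrand makes the two agree.\<close>

lemma LINT_eq_integral_continuous:
  fixes f :: "real \<Rightarrow> 'a::euclidean_space"
  assumes "continuous_on {a..b} f"
  shows "(LINT x|lebesgue_on {a..b}. f x) = integral {a..b} f"
  by (rule lebesgue_integral_eq_integral) (use assms in \<open>auto intro: continuous_imp_integrable_real\<close>)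

text \<open>Both iterated integrals are converted to \<open>integral\<close>, where the exchange for
  continuous integrands applies. The inner conversion needs continuous sections, the outer one a
  partial integral that is continuous in the remaining variable.\<close>

lemma LINT_swap_continuous:
  fixes f :: "real \<Rightarrow> real \<Rightarrow> real"
  assumes cont: "continuous_on ({a..b} \<times> {c..d}) (\<lambda>(x, y). f x y)"
  shows "(LINT x|lebesgue_on {a..b}. LINT y|lebesgue_on {c..d}. f x y) =
         (LINT y|lebesgue_on {c..d}. LINT x|lebesgue_on {a..b}. f x y)"
proof -
  have swap: "continuous_on ({c..d} \<times> {a..b}) (\<lambda>(y, x). f x y)"
    using continuous_on_swap_args[OF cont] .
  have fst_section: "continuous_on {c..d} (f x)" if "x \<in> {a..b}" for x
    using continuous_on_compose2[OF cont, of "{c..d}" "\<lambda>y. (x, y)"] that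
    by (auto simp: continuous_on_Pair continuous_on_const continuous_on_id image_subset_iff)
  have snd_section: "continuous_on {a..b} (\<lambda>x. f x y)" if "y \<in> {c..d}" for y
    using continuous_on_compose2[OF cont, of "{a..b}" "\<lambda>x. (x, y)"] that
    by (auto simp: continuous_on_Pair continuous_on_const continuous_on_id image_subset_iff)
  have inner_y: "(LINT y|lebesgue_on {c..d}. f x y) = integral {c..d} (f x)"
    if "x \<in> {a..b}" for x
    by (intro LINT_eq_integral_continuous fst_section that)
  have inner_x: "(LINT x|lebesgue_on {a..b}. f x y) = integral {a..b} (\<lambda>x. f x y)"
    if "y \<in> {c..d}" for y
    by (intro LINT_eq_integral_continuous snd_section that)
  have cont_y: "continuous_on {a..b} (\<lambda>x. integral {c..d} (f x))"
    using integral_continuous_on_param[of "{a..b}" c d f] cont by simp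
  have cont_x: "continuous_on {c..d} (\<lambda>y. integral {a..b} (\<lambda>x. f x y))"
    using integral_continuous_on_param[of "{c..d}" a b "\<lambda>y x. f x y"] swap by simp
  have "(LINT x|lebesgue_on {a..b}. LINT y|lebesgue_on {c..d}. f x y) =
        (LINT x|lebesgue_on {a..b}. integral {c..d} (f x))"
    by (rule Bochner_Integration.integral_cong) (auto simp: inner_y)
  also have "\<dots> = integral {a..b} (\<lambda>x. integral {c..d} (f x))"
    by (simp add: LINT_eq_integral_continuous cont_y)
  also have "\<dots> = integral {c..d} (\<lambda>y. integral {a..b} (\<lambda>x. f x y))"
    using integral_swap_continuous[of a c b d f] cont by (simp add: cbox_Pair_eq)
  also have "\<dots> = (LINT y|lebesgue_on {c..d}. integral {a..b} (\<lambda>x. f x y))"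
    by (simp add: LINT_eq_integral_continuous cont_x)
  also have "\<dots> = (LINT y|lebesgue_on {c..d}. LINT x|lebesgue_on {a..b}. f x y)"
    by (rule Bochner_Integration.integral_cong) (auto simp: inner_x)
  finally show ?thesis .
qed

lemma inner_L2_commute: "inner_L2 \<tau> z w = inner_L2 \<tau> w z"
  by (simp add: inner_L2_def inner_commute)

text \<open>States are written as \<open>(\<phi> 0, \<phi>)\<close> to build in the constraint of
  the state space. The factors \<open>\<tau>\<close> have two origins: the integral of a constant
  over an interval of length \<open>\<tau>\<close>, and the definition of \<open>P_op\<close>. The
  first alone gives the factor of the \<open>R (0, s)\<close> term, the second alone that of the
  \<open>R (s, 0)\<close> and \<open>S s\<close> terms, and both together give the square.\<close>

lemma inner_L2_P_op:
  fixes R :: "real \<times> real \<Rightarrow> real^'n^'n"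
  assumes "\<tau> \<ge> 0"
    and S: "continuous_on {-\<tau>..0} S"
    and R: "continuous_on ({-\<tau>..0} \<times> {-\<tau>..0}) R"
    and \<psi>: "continuous_on {-\<tau>..0} \<psi>"
    and \<phi>: "continuous_on {-\<tau>..0} \<phi>"
  shows "inner_L2 \<tau> (\<psi> 0, \<psi>) (P_op \<tau> R S (\<phi> 0, \<phi>)) =
      \<tau>\<^sup>2 * (\<psi> 0 \<bullet> ((R (0, 0) + S 0) *v \<phi> 0))
    + \<tau> * (LINT s|lebesgue_on {-\<tau>..0}. \<psi> 0 \<bullet> (R (0, s) *v \<phi> s))
    + \<tau> * (LINT s|lebesgue_on {-\<tau>..0}. \<psi> s \<bullet> (R (s, 0) *v \<phi> 0))
    + \<tau> * (LINT s|lebesgue_on {-\<tau>..0}. \<psi> s \<bullet> (S s *v \<phi> s))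
    + (LINT s|lebesgue_on {-\<tau>..0}. LINT \<theta>|lebesgue_on {-\<tau>..0}. \<psi> s \<bullet> (R (s, \<theta>) *v \<phi> \<theta>))"
proof -
  let ?M = "lebesgue_on {-\<tau>..0}"
  \<comment> \<open>The same integral term occurs in both components of \<open>P_op\<close>: as
    \<open>J 0\<close> in the first and as \<open>J s\<close> in the second.\<close>
  define J where "J s = (LINT \<theta>|?M. R (s, \<theta>) *v \<phi> \<theta>)" for s
  have 0: "0 \<in> {-\<tau>..0}"
    using \<open>\<tau> \<ge> 0\<close> by simp
  have kernel: "continuous_on ({-\<tau>..0} \<times> {-\<tau>..0}) (\<lambda>(s, \<theta>). R (s, \<theta>) *v \<phi> \<theta>)"
    using R by (auto simp: case_prod_unfold
        intro!: continuous_on_matrix_vector_mult continuous_on_compose2[OF \<phi>] continuous_intros)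
  have R_fst: "continuous_on {-\<tau>..0} (\<lambda>\<theta>. R (s, \<theta>))" if "s \<in> {-\<tau>..0}" for s
    using that by (intro continuous_on_compose2[OF R]) (auto intro!: continuous_intros)
  have R_snd: "continuous_on {-\<tau>..0} (\<lambda>s. R (s, 0))"
    using 0 by (intro continuous_on_compose2[OF R]) (auto intro!: continuous_intros)
  have integrable_section: "integrable ?M (\<lambda>\<theta>. R (s, \<theta>) *v \<phi> \<theta>)" if "s \<in> {-\<tau>..0}" for s
    by (intro continuous_imp_integrable_real continuous_on_matrix_vector_mult R_fst \<phi> that)
  have J: "J s = integral {-\<tau>..0} (\<lambda>\<theta>. R (s, \<theta>) *v \<phi> \<theta>)" if "s \<in> {-\<tau>..0}" for s
    using integrable_section[OF that] by (simp add: J_def lebesgue_integral_eq_integral)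
  \<comment> \<open>Continuity of \<open>J\<close> is what makes the term
    \<open>\<psi> s \<bullet> J s\<close> integrable below.\<close>
  have cont_J: "continuous_on {-\<tau>..0} J"
    using integral_continuous_on_param[of "{-\<tau>..0}" "-\<tau>" 0 "\<lambda>s \<theta>. R (s, \<theta>) *v \<phi> \<theta>"] kernel
    by (simp add: J cong: continuous_on_cong_simp)
  have inner_J: "x \<bullet> J s = (LINT \<theta>|?M. x \<bullet> (R (s, \<theta>) *v \<phi> \<theta>))" if "s \<in> {-\<tau>..0}" for x s
    unfolding J_def using integrable_section[OF that] by simp
  have measure: "measure ?M {-\<tau>..0} = \<tau>"
    using \<open>\<tau> \<ge> 0\<close> by (simp add: measure_restrict_space)
  have integrable_1: "integrable ?M (\<lambda>s. \<psi> s \<bullet> (R (s, 0) *v \<phi> 0))"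
    by (intro continuous_imp_integrable_real continuous_on_inner
        continuous_on_matrix_vector_mult continuous_on_const R_snd \<psi>)
  have integrable_2: "integrable ?M (\<lambda>s. \<psi> s \<bullet> (S s *v \<phi> s))"
    by (intro continuous_imp_integrable_real continuous_on_inner
        continuous_on_matrix_vector_mult S \<psi> \<phi>)
  have integrable_3: "integrable ?M (\<lambda>s. \<psi> s \<bullet> J s)"
    by (intro continuous_imp_integrable_real continuous_on_inner cont_J \<psi>)
  have integrable_const: "integrable ?M (\<lambda>s. c)" for c :: real
    by (intro continuous_imp_integrable_real continuous_on_const)
  \<comment> \<open>The contribution of the first components does not depend on \<open>s\<close>; it
    is grouped so that integration multiplies it by \<open>\<tau>\<close>.\<close>
  have "inner_L2 \<tau> (\<psi> 0, \<psi>) (P_op \<tau> R S (\<phi> 0, \<phi>)) =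
      (LINT s|?M. (\<tau> * (\<psi> 0 \<bullet> ((R (0, 0) + S 0) *v \<phi> 0)) + \<psi> 0 \<bullet> J 0)
        + \<tau> * (\<psi> s \<bullet> (R (s, 0) *v \<phi> 0)) + \<tau> * (\<psi> s \<bullet> (S s *v \<phi> s)) + \<psi> s \<bullet> J s)"
    by (simp add: inner_L2_def P_op_def J_def inner_add_right add.assoc)
  also have "\<dots> = \<tau> * (\<tau> * (\<psi> 0 \<bullet> ((R (0, 0) + S 0) *v \<phi> 0)) + \<psi> 0 \<bullet> J 0)
        + \<tau> * (LINT s|?M. \<psi> s \<bullet> (R (s, 0) *v \<phi> 0))
        + \<tau> * (LINT s|?M. \<psi> s \<bullet> (S s *v \<phi> s)) + (LINT s|?M. \<psi> s \<bullet> J s)"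
    using integrable_1 integrable_2 integrable_3 integrable_const measure by simp
  also have "(LINT s|?M. \<psi> s \<bullet> J s) = (LINT s|?M. LINT \<theta>|?M. \<psi> s \<bullet> (R (s, \<theta>) *v \<phi> \<theta>))"
    by (rule Bochner_Integration.integral_cong) (auto simp: inner_J)
  finally show ?thesis
    by (simp add: inner_J[OF 0] power2_eq_square distrib_left)
qed

theorem lemma2:
  fixes \<tau> :: real
    and S :: "real \<Rightarrow> real^'n^'n"
    and R :: "real \<times> real \<Rightarrow> real^'n^'n"
  assumes "\<tau> > 0"
    and "S \<in> W2 {-\<tau>..0}"
    and "R \<in> W2 ({-\<tau>..0} \<times> {-\<tau>..0})"
    and "\<And>s. s \<in> {-\<tau>..0} \<Longrightarrow> (\<lambda>\<theta>. R (s, \<theta>)) \<in> W2 {-\<tau>..0}"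
    and "(\<lambda>s. R (s, 0)) \<in> W2 {-\<tau>..0}"
    and "\<And>s \<theta>. s \<in> {-\<tau>..0} \<Longrightarrow> \<theta> \<in> {-\<tau>..0} \<Longrightarrow> R (s, \<theta>) = transpose (R (\<theta>, s))"
    and "\<And>s. s \<in> {-\<tau>..0} \<Longrightarrow> transpose (S s) = S s"
  shows "\<forall>z \<in> state_space \<tau>. \<forall>w \<in> state_space \<tau>.
           inner_L2 \<tau> z (P_op \<tau> R S w) = inner_L2 \<tau> (P_op \<tau> R S z) w"
proof (intro ballI)
  fix z w :: "(real^'n) \<times> (real \<Rightarrow> real^'n)"
  assume z: "z \<in> state_space \<tau>" and w: "w \<in> state_space \<tau>"
  let ?M = "lebesgue_on {-\<tau>..0}"
  \<comment> \<open>Membership in the state space makes the vector part the value at 0, and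
    \<open>W2\<close> supplies the continuity that the expansion requires.\<close>
  obtain \<psi> where \<psi>: "z = (\<psi> 0, \<psi>)" "continuous_on {-\<tau>..0} \<psi>"
    using z by (auto simp: state_space_def W2_def)
  obtain \<phi> where \<phi>: "w = (\<phi> 0, \<phi>)" "continuous_on {-\<tau>..0} \<phi>"
    using w by (auto simp: state_space_def W2_def)
  have S: "continuous_on {-\<tau>..0} S" and R: "continuous_on ({-\<tau>..0} \<times> {-\<tau>..0}) R"
    using assms(2,3) by (auto simp: W2_def)
  have 0: "0 \<in> {-\<tau>..0}" and "\<tau> \<ge> 0"
    using \<open>\<tau> > 0\<close> by simp_all
  have R_sym: "x \<bullet> (R (s, \<theta>) *v y) = y \<bullet> (R (\<theta>, s) *v x)"
    if "s \<in> {-\<tau>..0}" "\<theta> \<in> {-\<tau>..0}" for x y s \<theta>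
    unfolding assms(6)[OF that] by (rule inner_transpose_mult)
  have S_sym: "x \<bullet> (S s *v y) = y \<bullet> (S s *v x)" if "s \<in> {-\<tau>..0}" for x y s
    using inner_transpose_mult[of x "S s" y] assms(7)[OF that] by simp
  have const: "\<psi> 0 \<bullet> ((R (0, 0) + S 0) *v \<phi> 0) = \<phi> 0 \<bullet> ((R (0, 0) + S 0) *v \<psi> 0)"
    using R_sym[OF 0 0] S_sym[OF 0]
    by (simp add: matrix_vector_mult_add_rdistrib inner_add_right)
  \<comment> \<open>Stated for arbitrary \<open>f\<close> and \<open>g\<close> because it is used in
    both orders: each \<open>R (0, s)\<close> term of one expansion becomes the
    \<open>R (s, 0)\<close> term of the other.\<close>
  have cross: "(LINT s|?M. f 0 \<bullet> (R (0, s) *v g s)) = (LINT s|?M. g s \<bullet> (R (s, 0) *v f 0))"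
    for f g :: "real \<Rightarrow> real^'n"
    using 0 by (intro Bochner_Integration.integral_cong) (auto intro!: R_sym)
  have mult: "(LINT s|?M. \<psi> s \<bullet> (S s *v \<phi> s)) = (LINT s|?M. \<phi> s \<bullet> (S s *v \<psi> s))"
    by (intro Bochner_Integration.integral_cong) (auto intro!: S_sym)
  have "continuous_on ({-\<tau>..0} \<times> {-\<tau>..0}) (\<lambda>(s, \<theta>). \<psi> s \<bullet> (R (s, \<theta>) *v \<phi> \<theta>))"
    using R by (auto simp: case_prod_unfold
        intro!: continuous_on_inner continuous_on_matrix_vector_mult continuous_on_compose2[OF \<phi>(2)]
          continuous_on_compose2[OF \<psi>(2)] continuous_intros)
  then have "(LINT s|?M. LINT \<theta>|?M. \<psi> s \<bullet> (R (s, \<theta>) *v \<phi> \<theta>)) =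
      (LINT \<theta>|?M. LINT s|?M. \<psi> s \<bullet> (R (s, \<theta>) *v \<phi> \<theta>))"
    by (rule LINT_swap_continuous)
  \<comment> \<open>After the exchange, symmetry of the kernel turns the integrand into that of the
    other expansion, with the names of the two bound variables interchanged.\<close>
  also have "\<dots> = (LINT \<theta>|?M. LINT s|?M. \<phi> \<theta> \<bullet> (R (\<theta>, s) *v \<psi> s))"
    by (intro Bochner_Integration.integral_cong refl) (auto intro!: R_sym)
  finally have double: "(LINT s|?M. LINT \<theta>|?M. \<psi> s \<bullet> (R (s, \<theta>) *v \<phi> \<theta>)) =
      (LINT s|?M. LINT \<theta>|?M. \<phi> s \<bullet> (R (s, \<theta>) *v \<psi> \<theta>))" .
  \<comment> \<open>Expanding both sides with the roles of the two states exchanged leaves equal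
    terms; symmetry of the inner product then moves the operator to the first argument.\<close>
  have "inner_L2 \<tau> z (P_op \<tau> R S w) = inner_L2 \<tau> w (P_op \<tau> R S z)"
    unfolding \<psi>(1) \<phi>(1) inner_L2_P_op[OF \<open>\<tau> \<ge> 0\<close> S R \<psi>(2) \<phi>(2)]
      inner_L2_P_op[OF \<open>\<tau> \<ge> 0\<close> S R \<phi>(2) \<psi>(2)]
    by (simp add: const cross mult double)
  then show "inner_L2 \<tau> z (P_op \<tau> R S w) = inner_L2 \<tau> (P_op \<tau> R S z) w"
    by (simp add: inner_L2_commute)
qed

end
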